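(* Let $H:\mathbb R^n\times\mathbb R^n\to\mathbb R$, $(p,y)\mapsto H(p,y)$, be smooth, $\mathbb Z^n$-periodic in $y$, with $\sup_y|H(0,y)|<\infty$, $\sup_y|D_yH(p,y)|\le C_0(1+|p|)$, and $H(p,y)\to\infty$ as $|p|\to\infty$ uniformly in $y$. Fix $P\in\mathbb R^n$, and for $\theta\in(0,1)$ let $z^{\theta}$ be the ($\mathbb Z^n$-periodic) solution of $\theta z^{\theta}+H(P+Dz^{\theta},y)=\theta^2\Delta z^{\theta}$ in $\mathbb R^n$. Then there is a constant $C>0$ independent of $\theta$ such that $\left|\frac{\partial(\theta z^{\theta})}{\partial\theta}(x)\right|\le C$ for all $x\in\mathbb R^n$.
   Context: The solutions satisfy the standard bounds $\|\theta z^\theta\|_{L^\infty},\|Dz^\theta\|_{L^\infty}\le C$ uniformly in $\theta$, and depend smoothly on $\theta$. *)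

theory Defs
  imports "HOL-Analysis.Analysis"
begin

coinductive smooth_on :: "'a::euclidean_space set \<Rightarrow> ('a \<Rightarrow> real) \<Rightarrow> bool" where
  "f differentiable_on S \<Longrightarrow> continuous_on S f \<Longrightarrow>
   (\<forall>v. smooth_on S (\<lambda>x. frechet_derivative f (at x) v)) \<Longrightarrow> smooth_on S f"

definition pdx :: "(real^'n \<Rightarrow> real) \<Rightarrow> 'n \<Rightarrow> real^'n \<Rightarrow> real" where
  "pdx f i x = frechet_derivative f (at x) (axis i 1)"

definition grad :: "(real^'n \<Rightarrow> real) \<Rightarrow> real^'n \<Rightarrow> real^'n" where
  "grad f x = (\<chi> i. pdx f i x)"

definition lap :: "(real^'n \<Rightarrow> real) \<Rightarrow> real^'n \<Rightarrow> real" where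
  "lap f x = (\<Sum>i\<in>UNIV. pdx (\<lambda>y. pdx f i y) i x)"

definition int_vec :: "real^'n \<Rightarrow> bool" where
  "int_vec k \<longleftrightarrow> (\<forall>i. k $ i \<in> \<int>)"

end

theory Submission
  imports Defs
begin

text \<open>
  Write \<open>z\<close> for the solution, \<open>w\<close> for its derivative in \<open>\<theta>\<close>, and \<open>L v = \<theta> v + D\<^sub>pH \<cdot> D v - \<theta>\<^sup>2 \<Delta> v\<close>
  for the linearized operator.  Differentiating the equation in \<open>\<theta>\<close> gives \<open>L w = 2 \<theta> \<Delta> z - z\<close>, and
  Bernstein's computation gives \<open>L \<bar>D z\<bar>\<^sup>2 = - \<theta> \<bar>D z\<bar>\<^sup>2 - 2 D z \<cdot> D\<^sub>yH - 2 \<theta>\<^sup>2 \<bar>D\<^sup>2 z\<bar>\<^sup>2\<close>.  For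
  \<open>\<sigma> = \<plusminus>1\<close> the good term \<open>- 2 \<theta>\<^sup>2 \<bar>D\<^sup>2 z\<bar>\<^sup>2\<close> absorbs \<open>2 \<sigma> \<theta> \<Delta> z\<close> up to \<open>n / 2\<close>, so the maximum principle
  for \<open>\<sigma> w + \<bar>D z\<bar>\<^sup>2\<close> bounds \<open>\<sigma> (z + \<theta> w)\<close> at a maximum point.  Since \<open>D z\<close> is bounded and \<open>z\<close> is
  periodic, \<open>z\<close> has bounded oscillation, and the bound extends from the maximum point to all of space.
\<close>

subsection \<open>Directional derivatives of smooth functions\<close>

text \<open>The direction is the first argument, so \<open>dir_deriv v\<close> is an operator on
  functions that can be iterated and that preserves \<open>smooth_on\<close>.\<close>

definition dir_deriv :: "'a::real_normed_vector \<Rightarrow> ('a \<Rightarrow> real) \<Rightarrow> 'a \<Rightarrow> real" where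
  "dir_deriv v f x = frechet_derivative f (at x) v"

lemma smooth_on_dir_deriv: "smooth_on S f \<Longrightarrow> smooth_on S (dir_deriv v f)"
  by (erule smooth_on.cases) (simp add: dir_deriv_def[abs_def])

lemma smooth_on_imp_continuous_on: "smooth_on S f \<Longrightarrow> continuous_on S f"
  by (erule smooth_on.cases) simp

lemma smooth_on_imp_has_derivative:
  assumes "smooth_on S f" "open S" "x \<in> S"
  shows "(f has_derivative (\<lambda>v. dir_deriv v f x)) (at x)"
proof -
  have "f differentiable_on S"
    using assms(1) by (rule smooth_on.cases) simp
  then have "f differentiable (at x)"
    using assms(2,3) differentiable_on_eq_differentiable_at by blast
  then show ?thesis
    unfolding dir_deriv_def using frechet_derivative_works by metis
qed

lemma dir_deriv_eqI: "(f has_derivative f') (at x) \<Longrightarrow> dir_deriv v f x = f' v"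
  unfolding dir_deriv_def using frechet_derivative_at by metis

lemma dir_deriv_cong:
  assumes "smooth_on S f" "open S" "x \<in> S" "\<And>y. y \<in> S \<Longrightarrow> f y = g y"
  shows "dir_deriv v f x = dir_deriv v g x"
  using has_derivative_transform_within_open[OF smooth_on_imp_has_derivative[OF assms(1-3)] assms(2,3)]
    assms(4) dir_deriv_eqI by metis

lemma has_real_derivative_line:
  assumes "smooth_on S f" "open S" "x + s *\<^sub>R v \<in> S"
  shows "((\<lambda>r. f (x + r *\<^sub>R v)) has_real_derivative dir_deriv v f (x + s *\<^sub>R v)) (at s)"
proof -
  have "(f has_derivative (\<lambda>w. dir_deriv w f (x + s *\<^sub>R v))) (at (x + s *\<^sub>R v))"
    using smooth_on_imp_has_derivative[OF assms] .
  moreover have "((\<lambda>r. x + r *\<^sub>R v) has_derivative (\<lambda>r. r *\<^sub>R v)) (at s)"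
    by (auto intro!: derivative_eq_intros)
  ultimately have
    "((\<lambda>r. f (x + r *\<^sub>R v)) has_derivative (\<lambda>r. dir_deriv (r *\<^sub>R v) f (x + s *\<^sub>R v))) (at s)"
    using has_derivative_compose by fastforce
  moreover have "dir_deriv (r *\<^sub>R v) f (x + s *\<^sub>R v) = r * dir_deriv v f (x + s *\<^sub>R v)" for r
    using linear_scale[OF has_derivative_linear[OF smooth_on_imp_has_derivative[OF assms]]] by simp
  ultimately show ?thesis
    unfolding has_field_derivative_def by (simp add: mult_commute_abs)
qed

text \<open>The mean value theorem is used twice, along \<open>u\<close> for the increment in
  direction \<open>v\<close>, then along \<open>v\<close> for \<open>dir_deriv u f\<close>. The left
  side is symmetric in \<open>u\<close> and \<open>v\<close>, which yields the equality of mixed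
  derivatives.\<close>

lemma second_difference_mvt:
  fixes x :: "'a::euclidean_space"
  assumes f: "smooth_on S f" "open S" and d: "ball x d \<subseteq> S"
    and h: "0 < h" "h * (norm u + norm v) < d"
  shows "\<exists>y. dist x y < d \<and>
    f (x + h *\<^sub>R u + h *\<^sub>R v) - f (x + h *\<^sub>R u) - f (x + h *\<^sub>R v) + f x
      = h\<^sup>2 * dir_deriv v (dir_deriv u f) y"
proof -
  have inball: "dist x (x + s *\<^sub>R u + r *\<^sub>R v) < d" if "0 \<le> s" "s \<le> h" "0 \<le> r" "r \<le> h" for s r
  proof -
    have "dist x (x + s *\<^sub>R u + r *\<^sub>R v) = norm (s *\<^sub>R u + r *\<^sub>R v)"
      by (metis add.assoc dist_add_cancel dist_0_norm add.right_neutral)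
    also have "\<dots> \<le> s * norm u + r * norm v"
      using norm_triangle_ineq[of "s *\<^sub>R u" "r *\<^sub>R v"] that by simp
    also have "\<dots> \<le> h * norm u + h * norm v"
      using that by (intro add_mono mult_right_mono) auto
    finally show ?thesis using h(2) by (simp add: distrib_left)
  qed
  then have inS: "x + s *\<^sub>R u + r *\<^sub>R v \<in> S" if "0 \<le> s" "s \<le> h" "0 \<le> r" "r \<le> h" for s r
    using d that by (meson mem_ball subsetD)
  define \<phi> where "\<phi> s = f (x + h *\<^sub>R v + s *\<^sub>R u) - f (x + s *\<^sub>R u)" for s
  have "\<exists>s. 0 < s \<and> s < h \<and> \<phi> h - \<phi> 0
      = (h - 0) * (dir_deriv u f (x + h *\<^sub>R v + s *\<^sub>R u) - dir_deriv u f (x + s *\<^sub>R u))"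
    unfolding \<phi>_def using h(1) inS[of _ h] inS[of _ 0]
    by (intro MVT2 DERIV_diff has_real_derivative_line[OF f]) (auto simp: algebra_simps)
  then obtain s where s: "0 < s" "s < h" and s_eq:
    "\<phi> h - \<phi> 0 = h * (dir_deriv u f (x + h *\<^sub>R v + s *\<^sub>R u) - dir_deriv u f (x + s *\<^sub>R u))"
    by auto
  have "\<exists>r. 0 < r \<and> r < h \<and> dir_deriv u f (x + s *\<^sub>R u + h *\<^sub>R v) - dir_deriv u f (x + s *\<^sub>R u + 0 *\<^sub>R v)
      = (h - 0) * dir_deriv v (dir_deriv u f) (x + s *\<^sub>R u + r *\<^sub>R v)"
    using h(1) s inS[of s]
    by (intro MVT2 has_real_derivative_line[OF smooth_on_dir_deriv[OF f(1)] f(2)]) auto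
  then obtain r where r: "0 < r" "r < h" and r_eq:
    "dir_deriv u f (x + s *\<^sub>R u + h *\<^sub>R v) - dir_deriv u f (x + s *\<^sub>R u)
      = h * dir_deriv v (dir_deriv u f) (x + s *\<^sub>R u + r *\<^sub>R v)"
    by auto
  have "\<phi> h - \<phi> 0 = h\<^sup>2 * dir_deriv v (dir_deriv u f) (x + s *\<^sub>R u + r *\<^sub>R v)"
    using s_eq r_eq by (simp add: algebra_simps power2_eq_square)
  moreover have "\<phi> h - \<phi> 0 = f (x + h *\<^sub>R u + h *\<^sub>R v) - f (x + h *\<^sub>R u) - f (x + h *\<^sub>R v) + f x"
    by (simp add: \<phi>_def algebra_simps)
  ultimately show ?thesis
    using inball[of s r] s r by (metis less_imp_le)
qed

lemma dir_deriv_commute: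
  fixes x :: "'a::euclidean_space"
  assumes f: "smooth_on S f" "open S" "x \<in> S"
  shows "dir_deriv u (dir_deriv v f) x = dir_deriv v (dir_deriv u f) x" (is "?A x = ?B x")
proof (rule ccontr)
  assume "?A x \<noteq> ?B x"
  \<comment> \<open>Half the gap: values within \<open>e\<close> of \<open>?A x\<close> and of
    \<open>?B x\<close> can never coincide.\<close>
  define e where "e = \<bar>?A x - ?B x\<bar> / 2"
  have e: "e > 0" using \<open>?A x \<noteq> ?B x\<close> by (simp add: e_def)
  have cont: "isCont ?A x" "isCont ?B x"
    using smooth_on_imp_continuous_on[OF smooth_on_dir_deriv[OF smooth_on_dir_deriv[OF f(1)]]] f(2,3)
      continuous_on_eq_continuous_at by blast+
  obtain d1 where d1: "d1 > 0" "\<And>y. dist y x < d1 \<Longrightarrow> dist (?A y) (?A x) < e"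
    using cont(1) e unfolding continuous_at_eps_delta by blast
  obtain d2 where d2: "d2 > 0" "\<And>y. dist y x < d2 \<Longrightarrow> dist (?B y) (?B x) < e"
    using cont(2) e unfolding continuous_at_eps_delta by blast
  obtain d3 where d3: "d3 > 0" "ball x d3 \<subseteq> S"
    using f(2,3) open_contains_ball by blast
  define d where "d = min d1 (min d2 d3)"
  have d: "d > 0" "ball x d \<subseteq> S" using d1(1) d2(1) d3 by (auto simp: d_def)
  \<comment> \<open>The summand 1 keeps the denominator positive when \<open>u\<close> and
    \<open>v\<close> vanish and makes the required inequality strict.\<close>
  define h where "h = d / (norm u + norm v + 1)"
  have pos: "norm u + norm v + 1 > 0" by (simp add: add_nonneg_pos)
  have h: "h > 0" using pos d(1) by (simp add: h_def)
  have "h * (norm u + norm v) < d"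
    using h pos d(1) by (simp add: h_def divide_simps)
  then obtain y y' where
    y: "dist x y < d" "f (x + h *\<^sub>R u + h *\<^sub>R v) - f (x + h *\<^sub>R u) - f (x + h *\<^sub>R v) + f x = h\<^sup>2 * ?B y"
    and y': "dist x y' < d"
      "f (x + h *\<^sub>R v + h *\<^sub>R u) - f (x + h *\<^sub>R v) - f (x + h *\<^sub>R u) + f x = h\<^sup>2 * ?A y'"
    using second_difference_mvt[OF f(1,2) d(2) h, of u v] second_difference_mvt[OF f(1,2) d(2) h, of v u]
    by (auto simp: add.commute)
  have "h\<^sup>2 * ?B y = h\<^sup>2 * ?A y'"
    using y(2) y'(2) by (simp add: algebra_simps)
  then have "?B y = ?A y'" using h by simp
  moreover have "dist (?A y') (?A x) < e" "dist (?B y) (?B x) < e"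
    using d1(2)[of y'] d2(2)[of y] y(1) y'(1) by (auto simp: d_def dist_commute)
  ultimately show False unfolding dist_real_def e_def by argo
qed

lemma dir_deriv_periodic:
  fixes f :: "'a::euclidean_space \<Rightarrow> real"
  assumes "smooth_on S f" "open S" "\<And>y. y \<in> S \<Longrightarrow> y + c \<in> S" "\<And>y. y \<in> S \<Longrightarrow> f (y + c) = f y"
    and "x \<in> S"
  shows "dir_deriv v f (x + c) = dir_deriv v f x"
proof -
  have "((\<lambda>y. f (y + c)) has_derivative (\<lambda>v. dir_deriv v f (x + c))) (at x)"
  proof (rule has_derivative_compose[of "\<lambda>y. y + c" "\<lambda>v. v" x UNIV f, simplified])
    show "((\<lambda>y. y + c) has_derivative (\<lambda>v. v)) (at x)"
      by (auto intro!: derivative_eq_intros)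
    show "(f has_derivative (\<lambda>v. dir_deriv v f (x + c))) (at (x + c))"
      using assms smooth_on_imp_has_derivative by blast
  qed
  then have "(f has_derivative (\<lambda>v. dir_deriv v f (x + c))) (at x)"
    using has_derivative_transform_within_open[OF _ assms(2,5)] assms(4) by blast
  from dir_deriv_eqI[OF this] show ?thesis by simp
qed

lemma has_derivative_slice:
  fixes f :: "'a::euclidean_space \<times> 'b::euclidean_space \<Rightarrow> real"
  assumes "smooth_on S f" "open S" "(t, x) \<in> S"
  shows "((\<lambda>y. f (t, y)) has_derivative (\<lambda>v. dir_deriv (0, v) f (t, x))) (at x)"
proof (rule has_derivative_compose[of "Pair t" "\<lambda>v. (0, v)" x UNIV f, simplified])
  show "(Pair t has_derivative Pair 0) (at x)"
    by (auto intro!: derivative_eq_intros)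
  show "(f has_derivative (\<lambda>v. dir_deriv v f (t, x))) (at (t, x))"
    using smooth_on_imp_has_derivative[OF assms] .
qed

lemma pdx_slice:
  fixes f :: "'a::euclidean_space \<times> (real^'n) \<Rightarrow> real"
  assumes "smooth_on S f" "open S" "(t, x) \<in> S"
  shows "pdx (\<lambda>y. f (t, y)) i x = dir_deriv (0, axis i 1) f (t, x)"
  unfolding pdx_def using frechet_derivative_at[OF has_derivative_slice[OF assms]] by metis

subsection \<open>Maxima and periodic functions\<close>

text \<open>If \<open>c\<close> were positive, \<open>g'\<close> would be positive just to the right
  of 0, and the mean value theorem would give a value above the maximum.\<close>

lemma derivatives_at_max:
  fixes g :: "real \<Rightarrow> real"
  assumes g: "\<And>s. (g has_real_derivative g' s) (at s)"
    and g': "(g' has_real_derivative c) (at 0)"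
    and max: "\<And>s. g s \<le> g 0"
  shows "g' 0 = 0" "c \<le> 0"
proof -
  show zero: "g' 0 = 0"
    using DERIV_local_max[OF g zero_less_one] max by blast
  show "c \<le> 0"
  proof (rule ccontr)
    assume "\<not> c \<le> 0"
    then obtain d where d: "d > 0" "\<And>h. 0 < h \<Longrightarrow> h < d \<Longrightarrow> g' 0 < g' (0 + h)"
      using DERIV_pos_inc_right[OF g'] by force
    obtain s where s: "0 < s" "s < d / 2" "g (d / 2) - g 0 = (d / 2 - 0) * g' s"
      using MVT2[of 0 "d / 2" g g'] g d(1) by auto
    have "g' s > 0" using d(2)[of s] s zero d(1) by simp
    then have "(d / 2 - 0) * g' s > 0" using d(1) by simp
    then have "g (d / 2) > g 0" using s(3) by linarith
    with max[of "d / 2"] show False by simp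
  qed
qed

lemma int_vec_translate:
  fixes x :: "real^'n"
  shows "\<exists>k. int_vec k \<and> x + k \<in> cbox 0 1"
proof (intro exI conjI)
  let ?k = "(\<chi> i. - of_int \<lfloor>x $ i\<rfloor>) :: real^'n"
  show "int_vec ?k" by (simp add: int_vec_def)
  show "x + ?k \<in> cbox 0 1"
    by (auto simp: mem_box_cart) linarith+
qed

lemma periodic_attains_max:
  fixes f :: "real^'n \<Rightarrow> real"
  assumes "\<And>x k. int_vec k \<Longrightarrow> f (x + k) = f x" "continuous_on UNIV f"
  shows "\<exists>x0. \<forall>x. f x \<le> f x0"
proof -
  have "(0::real^'n) \<in> cbox 0 1" by (simp add: mem_box_cart)
  then obtain x0 where "\<And>y. y \<in> cbox 0 1 \<Longrightarrow> f y \<le> f x0"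
    using continuous_attains_sup[OF compact_cbox _ continuous_on_subset[OF assms(2)], of 0 1] by blast
  then show ?thesis
    using int_vec_translate assms(1) by metis
qed

lemma frechet_derivative_eq_grad:
  fixes f :: "real^'n \<Rightarrow> real"
  assumes "(f has_derivative f') (at x)"
  shows "f' v = grad f x \<bullet> v"
proof -
  have lin: "linear f'" using assms has_derivative_linear by blast
  have "f' v = f' (\<Sum>i\<in>UNIV. v $ i *\<^sub>R axis i 1)"
    by (simp add: basis_expansion scalar_mult_eq_scaleR[symmetric])
  also have "\<dots> = (\<Sum>i\<in>UNIV. v $ i * f' (axis i 1))"
    by (simp add: linear_sum[OF lin] linear_scale[OF lin])
  also have "\<dots> = grad f x \<bullet> v"
    using frechet_derivative_at[OF assms]
    by (simp add: inner_vec_def grad_def pdx_def mult.commute)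
  finally show ?thesis .
qed

text \<open>Integer translations move both points into the unit cube, where the mean value
  inequality applies. The factor \<open>CARD('n)\<close> is the crude bound on the cube's diameter
  by the l1 norm.\<close>

lemma periodic_oscillation:
  fixes f :: "real^'n \<Rightarrow> real"
  assumes per: "\<And>x k. int_vec k \<Longrightarrow> f (x + k) = f x"
    and diff: "\<And>x. f differentiable (at x)"
    and bound: "\<And>x. norm (grad f x) \<le> C"
  shows "\<bar>f x - f y\<bar> \<le> C * CARD('n)"
proof -
  obtain k l where k: "int_vec k" "x + k \<in> cbox 0 1" and l: "int_vec l" "y + l \<in> cbox 0 1"
    using int_vec_translate by metis
  have "norm (f (x + k) - f (y + l)) \<le> C * norm (x + k - (y + l))"
  proof (rule differentiable_bound[of UNIV f "\<lambda>x v. grad f x \<bullet> v"])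
    show "(f has_derivative (\<lambda>v. grad f w \<bullet> v)) (at w within UNIV)" for w
    proof -
      have "(f has_derivative frechet_derivative f (at w)) (at w)"
        using diff frechet_derivative_works by blast
      moreover from this have "frechet_derivative f (at w) = (\<lambda>v. grad f w \<bullet> v)"
        using frechet_derivative_eq_grad by blast
      ultimately show ?thesis by simp
    qed
    show "onorm (\<lambda>v. grad f w \<bullet> v) \<le> C" for w
    proof (rule onorm_le)
      fix v
      show "norm (grad f w \<bullet> v) \<le> C * norm v"
        using Cauchy_Schwarz_ineq2[of "grad f w" v] mult_right_mono[OF bound[of w] norm_ge_zero[of v]]
        by simp
    qed
  qed auto
  moreover have "norm (x + k - (y + l)) \<le> CARD('n)"
  proof -
    have "norm (x + k - (y + l)) \<le> (\<Sum>i\<in>(UNIV::'n set). \<bar>(x + k - (y + l)) $ i\<bar>)"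
      by (rule norm_le_l1_cart)
    also have "\<dots> \<le> (\<Sum>i\<in>(UNIV::'n set). 1)"
    proof (rule sum_mono)
      fix i :: 'n
      have "0 \<le> (x + k) $ i" "(x + k) $ i \<le> 1" "0 \<le> (y + l) $ i" "(y + l) $ i \<le> 1"
        using k(2) l(2) by (auto simp: mem_box_cart)
      then show "\<bar>(x + k - (y + l)) $ i\<bar> \<le> 1" unfolding vector_minus_component by linarith
    qed
    finally show ?thesis by simp
  qed
  moreover have "C \<ge> 0" using bound[of x] norm_ge_zero order_trans by blast
  ultimately show ?thesis
    using per[OF k(1)] per[OF l(1)] mult_left_mono[of "norm (x + k - (y + l))" "CARD('n)" C]
    by simp
qed

subsection \<open>The maximum principle for the linearized equation\<close>

text \<open>
  The algebra of the maximum principle: \<open>w\<close>, \<open>DW\<close>, \<open>DDW\<close> stand for \<open>z\<^sub>\<theta>\<close>, \<open>\<partial>\<^sub>j z\<^sub>\<theta>\<close>, \<open>\<partial>\<^sub>i\<partial>\<^sub>i z\<^sub>\<theta>\<close>;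
  \<open>dz\<close>, \<open>DZ\<close>, \<open>DDZ\<close> for \<open>\<partial>\<^sub>k z\<close>, \<open>\<partial>\<^sub>i\<partial>\<^sub>k z\<close>, \<open>\<partial>\<^sub>i\<partial>\<^sub>i\<partial>\<^sub>k z\<close>; and \<open>b\<close>, \<open>h\<close> for \<open>D\<^sub>pH\<close>, \<open>D\<^sub>yH\<close>.
\<close>
lemma max_point_estimate:
  fixes dz b h DW DDW :: "'n::finite \<Rightarrow> real" and DZ DDZ :: "'n \<Rightarrow> 'n \<Rightarrow> real"
  assumes t: "0 < t" and \<sigma>: "\<sigma>\<^sup>2 = 1"
    and eq_t: "z0 + t * w + (\<Sum>j\<in>UNIV. b j * DW j)
      = 2 * t * (\<Sum>i\<in>UNIV. DZ i i) + t\<^sup>2 * (\<Sum>i\<in>UNIV. DDW i)"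
    and eq_x: "\<And>k. t * dz k + (\<Sum>j\<in>UNIV. b j * DZ k j) + h k = t\<^sup>2 * (\<Sum>i\<in>UNIV. DDZ k i)"
    and crit: "\<And>j. \<sigma> * DW j + 2 * (\<Sum>k\<in>UNIV. dz k * DZ k j) = 0"
    and concave: "\<And>i. \<sigma> * DDW i + 2 * (\<Sum>k\<in>UNIV. (DZ k i)\<^sup>2 + dz k * DDZ k i) \<le> 0"
    and M: "\<bar>\<Sum>k\<in>UNIV. dz k * h k\<bar> \<le> M"
  shows "\<sigma> * (z0 + t * w) \<le> CARD('n) / 2 + 2 * M"
proof -
  \<comment> \<open>\<open>Q\<close> is the squared Hilbert-Schmidt norm of the Hessian and
    \<open>ZZ\<close> is \<open>|Dz|^2\<close>; \<open>bZ\<close> is half the drift term applied to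
    \<open>|Dz|^2\<close>, and \<open>LZ\<close> is half its Laplacian minus
    \<open>Q\<close>.\<close>
  define bZ where "bZ = (\<Sum>k\<in>UNIV. dz k * (\<Sum>j\<in>UNIV. b j * DZ k j))"
  define LZ where "LZ = (\<Sum>k\<in>UNIV. dz k * (\<Sum>i\<in>UNIV. DDZ k i))"
  define Q where "Q = (\<Sum>i\<in>UNIV. \<Sum>k\<in>UNIV. (DZ k i)\<^sup>2)"
  define ZZ where "ZZ = (\<Sum>k\<in>UNIV. dz k * dz k)"
  \<comment> \<open>The drift acts on a function whose gradient vanishes at the point, so its
    unknown coefficients \<open>b\<close> cancel.\<close>
  have drift: "\<sigma> * (\<Sum>j\<in>UNIV. b j * DW j) + 2 * bZ = 0"
  proof -
    have "bZ = (\<Sum>k\<in>UNIV. \<Sum>j\<in>UNIV. b j * (dz k * DZ k j))"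
      unfolding bZ_def by (simp add: sum_distrib_left mult.left_commute)
    also have "\<dots> = (\<Sum>j\<in>UNIV. b j * (\<Sum>k\<in>UNIV. dz k * DZ k j))"
      by (subst sum.swap) (simp add: sum_distrib_left)
    finally have "\<sigma> * (\<Sum>j\<in>UNIV. b j * DW j) + 2 * bZ
        = (\<Sum>j\<in>UNIV. b j * (\<sigma> * DW j + 2 * (\<Sum>k\<in>UNIV. dz k * DZ k j)))"
      by (simp add: sum_distrib_left sum.distrib algebra_simps)
    then show ?thesis by (simp add: crit)
  qed
  have second: "\<sigma> * (\<Sum>i\<in>UNIV. DDW i) + 2 * LZ \<le> - 2 * Q"
  proof -
    have "LZ = (\<Sum>i\<in>UNIV. \<Sum>k\<in>UNIV. dz k * DDZ k i)"
      unfolding LZ_def by (subst sum.swap) (simp add: sum_distrib_left)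
    then have "\<sigma> * (\<Sum>i\<in>UNIV. DDW i) + 2 * LZ + 2 * Q
        = (\<Sum>i\<in>UNIV. \<sigma> * DDW i + 2 * (\<Sum>k\<in>UNIV. (DZ k i)\<^sup>2 + dz k * DDZ k i))"
      by (simp add: Q_def sum_distrib_left sum.distrib algebra_simps)
    also have "\<dots> \<le> 0" using concave by (intro sum_nonpos) simp
    finally show ?thesis by simp
  qed
  \<comment> \<open>Bernstein's identity: multiply the equation for the k-th partial derivative by
    \<open>dz k\<close> and sum over k.\<close>
  have gradient: "t * ZZ + bZ + (\<Sum>k\<in>UNIV. dz k * h k) = t\<^sup>2 * LZ"
  proof -
    have "(\<Sum>k\<in>UNIV. dz k * (t * dz k + (\<Sum>j\<in>UNIV. b j * DZ k j) + h k))
        = (\<Sum>k\<in>UNIV. dz k * (t\<^sup>2 * (\<Sum>i\<in>UNIV. DDZ k i)))"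
      using eq_x by simp
    then show ?thesis
      by (simp add: ZZ_def bZ_def LZ_def sum.distrib distrib_left sum_distrib_left mult.left_commute)
  qed
  have "2 * t * \<sigma> * (\<Sum>i\<in>UNIV. DZ i i) - 2 * t\<^sup>2 * Q
      \<le> 2 * t * \<sigma> * (\<Sum>i\<in>UNIV. DZ i i) - 2 * t\<^sup>2 * (\<Sum>i\<in>UNIV. (DZ i i)\<^sup>2)"
    unfolding Q_def by (intro diff_left_mono mult_left_mono sum_mono member_le_sum) auto
  also have "\<dots> = (\<Sum>i\<in>UNIV. 2 * t * \<sigma> * DZ i i - 2 * t\<^sup>2 * (DZ i i)\<^sup>2)"
    by (simp add: sum_subtractf sum_distrib_left)
  also have "\<dots> \<le> (\<Sum>i\<in>(UNIV::'n set). 1 / 2)"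
  proof (rule sum_mono)
    fix i
    \<comment> \<open>Completing the square costs 1/2 per coordinate, independently of
      \<open>t\<close>.\<close>
    have "0 \<le> 2 * (t * \<sigma> * DZ i i - 1 / 2)\<^sup>2" by simp
    also have "\<dots> = 2 * t\<^sup>2 * \<sigma>\<^sup>2 * (DZ i i)\<^sup>2 - 2 * t * \<sigma> * DZ i i + 1 / 2"
      by (simp add: power2_eq_square algebra_simps)
    finally show "2 * t * \<sigma> * DZ i i - 2 * t\<^sup>2 * (DZ i i)\<^sup>2 \<le> 1 / 2"
      by (simp add: \<sigma>)
  qed
  finally have diag: "2 * t * \<sigma> * (\<Sum>i\<in>UNIV. DZ i i) - 2 * t\<^sup>2 * Q \<le> CARD('n) / 2"
    by simp
  have "\<sigma> * (z0 + t * w) + \<sigma> * (\<Sum>j\<in>UNIV. b j * DW j)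
      = 2 * t * \<sigma> * (\<Sum>i\<in>UNIV. DZ i i) + t\<^sup>2 * (\<sigma> * (\<Sum>i\<in>UNIV. DDW i))"
    using arg_cong[OF eq_t, of "\<lambda>r. \<sigma> * r"] by (simp add: algebra_simps)
  \<comment> \<open>Adding twice \<open>gradient\<close> eliminates \<open>bZ\<close>; the remaining
    term in \<open>ZZ\<close> has a favourable sign.\<close>
  then have "\<sigma> * (z0 + t * w) = 2 * t * \<sigma> * (\<Sum>i\<in>UNIV. DZ i i)
      + t\<^sup>2 * (\<sigma> * (\<Sum>i\<in>UNIV. DDW i) + 2 * LZ) - 2 * (t * ZZ) - 2 * (\<Sum>k\<in>UNIV. dz k * h k)"
    using drift gradient unfolding distrib_left by linarith
  moreover have "t\<^sup>2 * (\<sigma> * (\<Sum>i\<in>UNIV. DDW i) + 2 * LZ) \<le> t\<^sup>2 * (- 2 * Q)"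
    using second by (intro mult_left_mono) auto
  moreover have "t * ZZ \<ge> 0" using t by (simp add: ZZ_def sum_nonneg)
  ultimately show ?thesis using diag M by (simp add: abs_le_iff)
qed

section \<open>Differentiating the equation in the parameter and in space\<close>

locale viscous_discounted_HJ =
  fixes H :: "real^'n \<Rightarrow> real^'n \<Rightarrow> real" and z :: "real \<Rightarrow> real^'n \<Rightarrow> real" and P :: "real^'n"
  assumes H_smooth: "smooth_on UNIV (\<lambda>(p, y). H p y)"
    and z_smooth: "smooth_on ({0<..<1} \<times> UNIV) (\<lambda>(t, x). z t x)"
    and z_eq: "\<And>t x. t \<in> {0<..<1} \<Longrightarrow>
               t * z t x + H (P + grad (z t) x) x = t\<^sup>2 * lap (z t) x"
begin

text \<open>Parameter and space are merged into one open slab, so both kinds of differentiation are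
  instances of \<open>dir_deriv\<close> and commute by one lemma.\<close>

abbreviation S :: "(real \<times> (real^'n)) set" where "S \<equiv> {0<..<1} \<times> UNIV"

abbreviation Z :: "real \<times> (real^'n) \<Rightarrow> real" where "Z \<equiv> \<lambda>(t, x). z t x"

abbreviation HH :: "(real^'n) \<times> (real^'n) \<Rightarrow> real" where "HH \<equiv> \<lambda>(p, y). H p y"

abbreviation Dt :: "(real \<times> (real^'n) \<Rightarrow> real) \<Rightarrow> real \<times> (real^'n) \<Rightarrow> real"
  where "Dt \<equiv> dir_deriv (1, 0)"

abbreviation Dx :: "'n \<Rightarrow> (real \<times> (real^'n) \<Rightarrow> real) \<Rightarrow> real \<times> (real^'n) \<Rightarrow> real"
  where "Dx i \<equiv> dir_deriv (0, axis i 1)"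

lemma open_S: "open S"
  by (simp add: open_Times)

lemma grad_nth:
  assumes "t \<in> {0<..<1}"
  shows "grad (z t) x $ i = Dx i Z (t, x)"
  using pdx_slice[OF z_smooth open_S, of t x i] assms by (simp add: grad_def)

lemma grad_eq:
  assumes "t \<in> {0<..<1}"
  shows "grad (z t) x = (\<Sum>i\<in>UNIV. Dx i Z (t, x) *\<^sub>R axis i 1)"
  using basis_expansion[of "grad (z t) x"] grad_nth[OF assms]
  by (simp add: scalar_mult_eq_scaleR)

lemma lap_eq:
  assumes "t \<in> {0<..<1}"
  shows "lap (z t) x = (\<Sum>i\<in>UNIV. Dx i (Dx i Z) (t, x))"
proof -
  have "pdx (z t) i = (\<lambda>y. Dx i Z (t, y))" for i
    using pdx_slice[OF z_smooth open_S, of t _ i] assms by auto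
  then show ?thesis
    using pdx_slice[OF smooth_on_dir_deriv[OF z_smooth] open_S] assms by (simp add: lap_def)
qed

text \<open>A general direction \<open>v\<close> treats both differentiations at once:
  \<open>(1, 0)\<close> gives the equation for the parameter derivative,
  \<open>(0, axis k 1)\<close> the one behind Bernstein's computation. Both sides of the equation
  are differentiated by the chain rule and compared.\<close>

lemma linearized_equation:
  fixes v :: "real \<times> (real^'n)"
  assumes q: "q = (t, x)" "t \<in> {0<..<1}"
  defines "f \<equiv> dir_deriv v Z"
  shows "fst v * z t x + t * f q
      + (\<Sum>j\<in>UNIV. dir_deriv (axis j 1, 0) HH (P + grad (z t) x, x) * Dx j f q)
      + grad (H (P + grad (z t) x)) x \<bullet> snd v
    = 2 * fst v * t * (\<Sum>i\<in>UNIV. Dx i (Dx i Z) q) + t\<^sup>2 * (\<Sum>i\<in>UNIV. Dx i (Dx i f) q)"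
proof -
  \<comment> \<open>The spatial gradient as a function on the product space, visibly differentiable
    in the parameter too.\<close>
  define G :: "real \<times> (real^'n) \<Rightarrow> real^'n" where "G q = (\<Sum>i\<in>UNIV. Dx i Z q *\<^sub>R axis i 1)" for q
  have qS: "q \<in> S" using q by simp
  note sm = z_smooth smooth_on_dir_deriv[OF z_smooth] smooth_on_dir_deriv[OF smooth_on_dir_deriv[OF z_smooth]]
  note der = sm[THEN smooth_on_imp_has_derivative, OF open_S qS]
  let ?p = "P + grad (z t) x"
  let ?K = "\<lambda>w. dir_deriv w HH (?p, x)"
  have Gq: "G q = grad (z t) x" using grad_eq[OF q(2)] by (simp add: G_def q(1))
  have K: "(HH has_derivative ?K) (at (?p, x))"
    using smooth_on_imp_has_derivative[OF H_smooth] by simp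
  have linK: "linear ?K" using K has_derivative_linear by blast
  have dG: "(G has_derivative (\<lambda>w. \<Sum>i\<in>UNIV. dir_deriv w (Dx i Z) q *\<^sub>R axis i 1)) (at q)"
    unfolding G_def by (auto intro!: derivative_eq_intros der)
  have "((\<lambda>q. (P + G q, snd q)) has_derivative
      (\<lambda>w. (\<Sum>i\<in>UNIV. dir_deriv w (Dx i Z) q *\<^sub>R axis i 1, snd w))) (at q)"
    by (auto intro!: derivative_eq_intros dG)
  then have dH: "((\<lambda>q. HH (P + G q, snd q)) has_derivative
      (\<lambda>w. ?K (\<Sum>i\<in>UNIV. dir_deriv w (Dx i Z) q *\<^sub>R axis i 1, snd w))) (at q)"
    by (rule has_derivative_compose) (use K Gq q(1) in simp)
  have lhs: "((\<lambda>q. fst q * Z q + HH (P + G q, snd q)) has_derivative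
      (\<lambda>w. fst w * Z q + fst q * dir_deriv w Z q
        + ?K (\<Sum>i\<in>UNIV. dir_deriv w (Dx i Z) q *\<^sub>R axis i 1, snd w))) (at q)"
    by (rule derivative_eq_intros dH der refl)+ (auto simp: algebra_simps)
  have rhs: "((\<lambda>q. (fst q)\<^sup>2 * (\<Sum>i\<in>UNIV. Dx i (Dx i Z) q)) has_derivative
      (\<lambda>w. 2 * fst w * fst q * (\<Sum>i\<in>UNIV. Dx i (Dx i Z) q)
        + (fst q)\<^sup>2 * (\<Sum>i\<in>UNIV. dir_deriv w (Dx i (Dx i Z)) q))) (at q)"
    by (rule derivative_eq_intros der refl)+ (auto simp: algebra_simps)
  have eq_S: "fst r * Z r + HH (P + G r, snd r) = (fst r)\<^sup>2 * (\<Sum>i\<in>UNIV. Dx i (Dx i Z) r)" if "r \<in> S" for r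
  proof -
    obtain s y where r: "r = (s, y)" by force
    then have s: "s \<in> {0<..<1}" using that by simp
    show ?thesis using z_eq[OF s, of y] by (simp add: r G_def grad_eq[OF s] lap_eq[OF s])
  qed
  have "((\<lambda>q. (fst q)\<^sup>2 * (\<Sum>i\<in>UNIV. Dx i (Dx i Z) q)) has_derivative
      (\<lambda>w. fst w * Z q + fst q * dir_deriv w Z q
        + ?K (\<Sum>i\<in>UNIV. dir_deriv w (Dx i Z) q *\<^sub>R axis i 1, snd w))) (at q)"
    by (rule has_derivative_transform_within_open[OF lhs open_S qS eq_S])
  from fun_cong[OF has_derivative_unique[OF this rhs], of v]
  have main: "fst v * z t x + t * f q
        + ?K (\<Sum>i\<in>UNIV. dir_deriv v (Dx i Z) q *\<^sub>R axis i 1, snd v)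
      = 2 * fst v * t * (\<Sum>i\<in>UNIV. Dx i (Dx i Z) q)
        + t\<^sup>2 * (\<Sum>i\<in>UNIV. dir_deriv v (Dx i (Dx i Z)) q)"
    by (simp add: q(1) f_def)
  have comm1: "dir_deriv v (Dx i Z) r = Dx i f r" if "r \<in> S" for i r
    unfolding f_def using dir_deriv_commute[OF z_smooth open_S that] .
  \<comment> \<open>The first exchange holds only on \<open>S\<close>; \<open>dir_deriv_cong\<close>
    allows differentiating it there.\<close>
  have comm2: "dir_deriv v (Dx i (Dx i Z)) q = Dx i (Dx i f) q" for i
  proof -
    have "dir_deriv v (Dx i (Dx i Z)) q = Dx i (dir_deriv v (Dx i Z)) q"
      using dir_deriv_commute[OF sm(2) open_S qS] .
    also have "\<dots> = Dx i (Dx i f) q"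
      using dir_deriv_cong[OF sm(3) open_S qS] comm1 by blast
    finally show ?thesis .
  qed
  have grad_H: "?K (0, snd v) = grad (H ?p) x \<bullet> snd v"
    using frechet_derivative_eq_grad[OF has_derivative_slice[OF H_smooth open_UNIV UNIV_I, of ?p x]] by simp
  have "?K (\<Sum>i\<in>UNIV. Dx i f q *\<^sub>R axis i 1, snd v)
      = ?K ((\<Sum>i\<in>UNIV. Dx i f q *\<^sub>R (axis i 1, 0)) + (0, snd v))"
    by (simp add: scaleR_Pair sum_prod plus_prod_def fst_sum snd_sum)
  also have "\<dots> = (\<Sum>j\<in>UNIV. ?K (axis j 1, 0) * Dx j f q) + grad (H ?p) x \<bullet> snd v"
    by (simp only: linear_add[OF linK] linear_sum[OF linK] linear_scale[OF linK] grad_H)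
      (simp add: mult.commute)
  finally show ?thesis
    using main comm1[OF qS] comm2 by simp
qed

lemma theta_derivative:
  assumes "t \<in> {0<..<1}"
  shows "deriv (\<lambda>s. s * z s x) t = z t x + t * Dt Z (t, x)"
proof -
  have "((\<lambda>r. Z ((0, x) + r *\<^sub>R (1, 0))) has_real_derivative Dt Z ((0, x) + t *\<^sub>R (1, 0))) (at t)"
    using assms by (intro has_real_derivative_line[OF z_smooth open_S]) simp
  then have "((\<lambda>s. z s x) has_real_derivative Dt Z (t, x)) (at t)" by simp
  then have "((\<lambda>s. s * z s x) has_real_derivative z t x + t * Dt Z (t, x)) (at t)"
    by (auto intro!: derivative_eq_intros)
  then show ?thesis by (rule DERIV_imp_deriv)
qed

text \<open>Restricting the maximized function to coordinate lines through \<open>x0\<close> turns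
  the maximum into one-variable conditions, which are the inputs \<open>crit\<close> and
  \<open>concave\<close> of \<open>max_point_estimate\<close>.\<close>

lemma max_point_bound:
  assumes t: "t \<in> {0<..<1}" and \<sigma>: "\<sigma>\<^sup>2 = (1::real)"
    and max: "\<And>x. \<sigma> * Dt Z (t, x) + (\<Sum>k\<in>UNIV. (Dx k Z (t, x))\<^sup>2)
      \<le> \<sigma> * Dt Z (t, x0) + (\<Sum>k\<in>UNIV. (Dx k Z (t, x0))\<^sup>2)"
    and M: "\<bar>grad (z t) x0 \<bullet> grad (H (P + grad (z t) x0)) x0\<bar> \<le> M"
  shows "\<sigma> * (z t x0 + t * Dt Z (t, x0)) \<le> CARD('n) / 2 + 2 * M"
proof -
  let ?q = "(t, x0)" and ?p = "P + grad (z t) x0"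
  let ?b = "\<lambda>j. dir_deriv (axis j 1, 0) HH (?p, x0)"
  have crit: "\<sigma> * Dx i (Dt Z) ?q + 2 * (\<Sum>k\<in>UNIV. Dx k Z ?q * Dx i (Dx k Z) ?q) = 0" (is ?crit)
    and concave: "\<sigma> * Dx i (Dx i (Dt Z)) ?q
      + 2 * (\<Sum>k\<in>UNIV. (Dx i (Dx k Z) ?q)\<^sup>2 + Dx k Z ?q * Dx i (Dx i (Dx k Z)) ?q) \<le> 0" (is ?concave)
    for i
  proof -
    let ?l = "\<lambda>s. ?q + s *\<^sub>R (0, axis i 1)"
    have line: "((\<lambda>r. g (?l r)) has_real_derivative Dx i g (?l s)) (at s)" if "smooth_on S g" for g s
      using t by (intro has_real_derivative_line[OF that open_S]) simp
    note sm = smooth_on_dir_deriv[OF z_smooth]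
    define g where "g s = \<sigma> * Dt Z (?l s) + (\<Sum>k\<in>UNIV. (Dx k Z (?l s))\<^sup>2)" for s
    define g' where "g' s = \<sigma> * Dx i (Dt Z) (?l s)
        + 2 * (\<Sum>k\<in>UNIV. Dx k Z (?l s) * Dx i (Dx k Z) (?l s))" for s
    have g: "(g has_real_derivative g' s) (at s)" for s
      unfolding g_def g'_def
      by (rule derivative_eq_intros line[OF sm] refl)+
        (simp add: sum_distrib_left algebra_simps)
    have g': "(g' has_real_derivative \<sigma> * Dx i (Dx i (Dt Z)) (?l 0) + 2 * (\<Sum>k\<in>UNIV.
        (Dx i (Dx k Z) (?l 0))\<^sup>2 + Dx k Z (?l 0) * Dx i (Dx i (Dx k Z)) (?l 0))) (at 0)"
      unfolding g'_def
      by (rule derivative_eq_intros line[OF sm] line[OF smooth_on_dir_deriv[OF sm]] refl)+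
        (simp add: power2_eq_square algebra_simps)
    have "g s \<le> g 0" for s
      using max[of "x0 + s *\<^sub>R axis i 1"] by (simp add: g_def)
    from derivatives_at_max[OF g g' this] show ?crit ?concave
      by (simp_all add: g'_def)
  qed
  have "grad (z t) x0 \<bullet> grad (H ?p) x0 = (\<Sum>k\<in>UNIV. Dx k Z ?q * grad (H ?p) x0 $ k)"
    by (subst (1) grad_eq[OF t]) (simp add: inner_sum_left inner_axis')
  then have bound: "\<bar>\<Sum>k\<in>UNIV. Dx k Z ?q * grad (H ?p) x0 $ k\<bar> \<le> M"
    using M by simp
  have eq_t: "z t x0 + t * Dt Z ?q + (\<Sum>j\<in>UNIV. ?b j * Dx j (Dt Z) ?q)
      = 2 * t * (\<Sum>i\<in>UNIV. Dx i (Dx i Z) ?q) + t\<^sup>2 * (\<Sum>i\<in>UNIV. Dx i (Dx i (Dt Z)) ?q)"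
    using linearized_equation[OF refl t, where v = "(1, 0)"] by simp
  have eq_x: "t * Dx k Z ?q + (\<Sum>j\<in>UNIV. ?b j * Dx j (Dx k Z) ?q) + grad (H ?p) x0 $ k
      = t\<^sup>2 * (\<Sum>i\<in>UNIV. Dx i (Dx i (Dx k Z)) ?q)" for k
    using linearized_equation[OF refl t, where v = "(0, axis k 1)"] by (simp add: inner_axis)
  show ?thesis
    by (rule max_point_estimate[OF _ \<sigma> eq_t eq_x crit concave bound]) (use t in simp)
qed

end

section \<open>From the maximum point to a uniform bound\<close>

theorem theorem5:
  fixes H :: "real^'n \<Rightarrow> real^'n \<Rightarrow> real"
    and z :: "real \<Rightarrow> real^'n \<Rightarrow> real"
    and P :: "real^'n"
    and C0 :: real
  assumes H_smooth: "smooth_on UNIV (\<lambda>(p, y). H p y)"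
    and H_per: "\<And>p y k. int_vec k \<Longrightarrow> H p (y + k) = H p y"
    and H0_bdd: "\<exists>M. \<forall>y. \<bar>H 0 y\<bar> \<le> M"
    and H_Dy: "\<And>p y. norm (grad (H p) y) \<le> C0 * (1 + norm p)"
    and H_coerc: "\<And>M. \<exists>R. \<forall>p y. norm p \<ge> R \<longrightarrow> H p y \<ge> M"
    and z_smooth: "smooth_on ({0<..<1} \<times> UNIV) (\<lambda>(t, x). z t x)"
    and z_per: "\<And>t x k. t \<in> {0<..<1} \<Longrightarrow> int_vec k \<Longrightarrow> z t (x + k) = z t x"
    and z_eq: "\<And>t x. t \<in> {0<..<1} \<Longrightarrow>
               t * z t x + H (P + grad (z t) x) x = t\<^sup>2 * lap (z t) x"
    and z_bounds: "\<exists>C. \<forall>t\<in>{0<..<1}. \<forall>x. \<bar>t * z t x\<bar> \<le> C \<and> norm (grad (z t) x) \<le> C"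
  shows "\<exists>C>0. \<forall>t\<in>{0<..<1}. \<forall>x. \<bar>deriv (\<lambda>s. s * z s x) t\<bar> \<le> C"
proof -
  interpret viscous_discounted_HJ H z P
    by unfold_locales (fact H_smooth z_smooth z_eq)+
  obtain C where C: "\<And>t x. t \<in> {0<..<1} \<Longrightarrow> norm (grad (z t) x) \<le> C"
    using z_bounds by blast
  have C_nonneg: "0 \<le> C" by (rule order_trans[OF norm_ge_zero C[of "1/2" 0]]) simp
  have C0_nonneg: "0 \<le> C0" using order_trans[OF norm_ge_zero H_Dy[of 0 0]] by simp
  \<comment> \<open>\<open>M\<close> bounds \<open>|Dz . D_yH|\<close> through the linear growth of
    \<open>D_yH\<close>. In \<open>K\<close>, the first two terms come from the maximum point,
    \<open>C\<^sup>2\<close> from the variation of \<open>|Dz|^2\<close>, and the last from the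
    oscillation of \<open>z\<close>.\<close>
  define M where "M = C * (C0 * (1 + (norm P + C)))"
  define K where "K = CARD('n) / 2 + 2 * M + C\<^sup>2 + C * CARD('n)"
  have "M \<ge> 0" using C_nonneg C0_nonneg by (simp add: M_def)
  then have "K > 0" using C_nonneg by (simp add: K_def add_pos_nonneg)
  have bound: "\<sigma> * (z t x + t * Dt Z (t, x)) \<le> K"
    if t: "t \<in> {0<..<1}" and \<sigma>: "\<sigma> = 1 \<or> \<sigma> = -1" for t x and \<sigma> :: real
  proof -
    \<comment> \<open>Translation by \<open>(0, k)\<close> preserves the slab, so every derivative
      inherits the periodicity and a maximum exists.\<close>
    have shift: "dir_deriv v Z (t, y + k) = dir_deriv v Z (t, y)" if "int_vec k" for v y k
      using dir_deriv_periodic[OF z_smooth open_S, of "(0, k)" "(t, y)" v] t z_per that by auto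
    define N where "N y = (\<Sum>k\<in>UNIV. (Dx k Z (t, y))\<^sup>2)" for y
    have N: "N y \<le> C\<^sup>2" "N y \<ge> 0" for y
    proof -
      have "N y = (norm (grad (z t) y))\<^sup>2"
        unfolding N_def power2_norm_eq_inner
        by (simp add: inner_vec_def grad_nth[OF t] power2_eq_square)
      then show "N y \<le> C\<^sup>2" "N y \<ge> 0"
        using C[OF t, of y] by (auto intro: power_mono)
    qed
    have "continuous_on UNIV (\<lambda>y. dir_deriv v Z (t, y))" for v
      using t by (intro continuous_on_compose2[OF
          smooth_on_imp_continuous_on[OF smooth_on_dir_deriv[OF z_smooth]]]) (auto intro!: continuous_intros)
    then have "continuous_on UNIV (\<lambda>y. \<sigma> * Dt Z (t, y) + N y)"
      unfolding N_def by (intro continuous_intros)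
    then obtain x0 where max: "\<And>y. \<sigma> * Dt Z (t, y) + N y \<le> \<sigma> * Dt Z (t, x0) + N x0"
      using periodic_attains_max[of "\<lambda>y. \<sigma> * Dt Z (t, y) + N y"] shift unfolding N_def by auto
    have "\<bar>grad (z t) x0 \<bullet> grad (H (P + grad (z t) x0)) x0\<bar>
        \<le> norm (grad (z t) x0) * norm (grad (H (P + grad (z t) x0)) x0)"
      by (rule Cauchy_Schwarz_ineq2)
    also have "\<dots> \<le> C * (C0 * (1 + norm (P + grad (z t) x0)))"
      using C[OF t] C_nonneg H_Dy by (intro mult_mono) auto
    also have "\<dots> \<le> M"
      unfolding M_def using norm_triangle_ineq[of P "grad (z t) x0"] C[OF t, of x0] C_nonneg C0_nonneg
      by (intro mult_left_mono) auto
    finally have at_max: "\<sigma> * (z t x0 + t * Dt Z (t, x0)) \<le> CARD('n) / 2 + 2 * M"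
      using max_point_bound[OF t _ max[unfolded N_def]] \<sigma> by auto
    \<comment> \<open>The bound on \<open>t * z t x\<close> allows \<open>z\<close> to be of size
      1/t; its oscillation, however, is bounded uniformly in \<open>t\<close>.\<close>
    have "(z t) differentiable (at y)" for y
      using has_derivative_slice[OF z_smooth open_S, of t y] t by (auto simp: differentiable_def)
    then have osc: "\<bar>z t x - z t x0\<bar> \<le> C * CARD('n)"
      using periodic_oscillation[of "z t" C x x0] z_per[OF t] C[OF t] by blast
    \<comment> \<open>The maximality inequality is multiplied by \<open>t\<close>, and t < 1 then
      removes the factor in front of \<open>C\<^sup>2\<close>.\<close>
    have "t * (\<sigma> * Dt Z (t, x) - \<sigma> * Dt Z (t, x0)) \<le> t * C\<^sup>2"
      using max[of x] N(1)[of x0] N(2)[of x] t by (intro mult_left_mono) auto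
    also have "\<dots> \<le> 1 * C\<^sup>2" using t by (intro mult_right_mono) auto
    finally have "t * (\<sigma> * Dt Z (t, x)) \<le> t * (\<sigma> * Dt Z (t, x0)) + C\<^sup>2"
      by (simp add: algebra_simps)
    moreover have "\<sigma> * z t x \<le> \<sigma> * z t x0 + C * CARD('n)"
      using osc \<sigma> by auto
    ultimately show ?thesis
      using at_max by (simp add: K_def algebra_simps)
  qed
  have "\<bar>deriv (\<lambda>s. s * z s x) t\<bar> \<le> K" if "t \<in> {0<..<1}" for t x
    using bound[OF that, of 1 x] bound[OF that, of "-1" x] theta_derivative[OF that, of x]
    by (simp add: abs_le_iff)
  with \<open>K > 0\<close> show ?thesis by blast
qed

end
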